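(* Let $X$ and $Y$ be separable Hilbert spaces and let $Q$ be the (injective, self-adjoint, positive, trace class) covariance operator of a nondegenerate centered Gaussian measure on $Y$, with eigensystem $(\lambda_k, e_k)_{k\in\mathbb{N}}$. Let $A: X \to Y$ be a linear operator such that $\operatorname{ran}(A) \subseteq \operatorname{ran}(Q)$ and $Q^{-1}A$ is bounded. Define $$\Phi(u,y) = \sum_{k=1}^\infty \left(\frac{(Au,e_k)_Y^2}{2\lambda_k} - \frac{(Au,e_k)_Y (y,e_k)_Y}{\lambda_k}\right), \quad u \in X,\ y \in Y.$$ Then for every $y \in Y$: (i) for every $r > 0$ there exists $L = L(r) > 0$ such that $|\Phi(u_1,y) - \Phi(u_2,y)| \le L\|u_1 - u_2\|_X$ for all $u_1, u_2 \in B_r(0)$; (ii) there exists $\underline{L} \ge 0$ such that $\Phi(u,y) \ge \Phi(0,y) - \underline{L}\|u\|_X$ for all $u \in X$.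
   Context: $\operatorname{ran}$ denotes the range of a mapping; $B_r(0)$ is the open ball of radius $r$ around $0$ in $X$. An eigensystem $(\lambda_k,e_k)_{k\in\mathbb{N}}$ of $Q$ consists of an orthonormal basis $(e_k)_{k\in\mathbb{N}}$ of $Y$ with $Qe_k = \lambda_k e_k$, $\lambda_k > 0$. *)

theory Defs
  imports "HOL-Probability.Probability"
begin

text \<open>
  Real separable Hilbert spaces are types of sort \<open>{real_inner, polish_space}\<close>. By the Riesz
  representation theorem the continuous linear functionals on such a space are the maps
  \<open>\<lambda>x. x \<bullet> y\<close>, so Gaussian measures are described through these one-dimensional marginals.
\<close>

text \<open>The first alternative is the Dirac measure at 0, i.e. the normal law with variance 0.\<close>

definition centered_gaussian_measure :: "'b::{real_inner, polish_space} measure \<Rightarrow> bool" where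
  "centered_gaussian_measure \<mu> \<longleftrightarrow>
     prob_space \<mu> \<and> sets \<mu> = sets borel \<and>
     (\<forall>y. distr \<mu> borel (\<lambda>x. x \<bullet> y) = return borel 0 \<or>
          (\<exists>\<sigma>>0. distributed \<mu> lborel (\<lambda>x. x \<bullet> y) (normal_density 0 \<sigma>)))"

definition nondegenerate_measure :: "'b::{real_inner, polish_space} measure \<Rightarrow> bool" where
  "nondegenerate_measure \<mu> \<longleftrightarrow> (\<forall>y. y \<noteq> 0 \<longrightarrow> \<not> (\<exists>c. AE x in \<mu>. x \<bullet> y = c))"

text \<open>No mean is subtracted, since this is only used for centered measures.\<close>

definition covariance_operator ::
    "'b::{real_inner, polish_space} measure \<Rightarrow> ('b \<Rightarrow> 'b) \<Rightarrow> bool" where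
  "covariance_operator \<mu> Q \<longleftrightarrow>
     bounded_linear Q \<and> (\<forall>y z. Q y \<bullet> z = (LINT x|\<mu>. (x \<bullet> y) * (x \<bullet> z)))"

definition orthonormal_basis :: "(nat \<Rightarrow> 'b::real_inner) \<Rightarrow> bool" where
  "orthonormal_basis e \<longleftrightarrow>
     (\<forall>i j. e i \<bullet> e j = (if i = j then 1 else 0)) \<and> closure (span (range e)) = UNIV"

definition eigensystem :: "('b::real_inner \<Rightarrow> 'b) \<Rightarrow> (nat \<Rightarrow> real) \<Rightarrow> (nat \<Rightarrow> 'b) \<Rightarrow> bool" where
  "eigensystem Q lam e \<longleftrightarrow>
     orthonormal_basis e \<and> (\<forall>k. Q (e k) = lam k *\<^sub>R e k \<and> lam k > 0)"

definition \<Phi> ::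
    "('a \<Rightarrow> 'b::real_inner) \<Rightarrow> (nat \<Rightarrow> real) \<Rightarrow> (nat \<Rightarrow> 'b) \<Rightarrow> 'a \<Rightarrow> 'b \<Rightarrow> real" where
  "\<Phi> A lam e u y =
     (\<Sum>k. (A u \<bullet> e k)\<^sup>2 / (2 * lam k) - (A u \<bullet> e k) * (y \<bullet> e k) / lam k)"

text \<open>
  A covariance operator of a nondegenerate centered Gaussian measure is self-adjoint, positive,
  injective and trace class, so these need not be assumed separately.
\<close>

lemma covariance_operator_self_adjoint:
  assumes "covariance_operator \<mu> Q"
  shows "Q y \<bullet> z = y \<bullet> Q z"
  using assms unfolding covariance_operator_def by (simp add: inner_commute[of y] mult.commute)

lemma centered_gaussian_moments:
  fixes y :: "'b::{real_inner, polish_space}"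
  assumes "centered_gaussian_measure \<mu>"
  shows "integrable \<mu> (\<lambda>x. (x \<bullet> y)\<^sup>2)" "integrable \<mu> (\<lambda>x. (x \<bullet> y) ^ 4)"
    "(LINT x|\<mu>. (x \<bullet> y) ^ 4) = 3 * (LINT x|\<mu>. (x \<bullet> y)\<^sup>2)\<^sup>2"
proof -
  have [measurable_cong]: "sets \<mu> = sets borel"
    using assms by (simp add: centered_gaussian_measure_def)
  have "integrable \<mu> (\<lambda>x. (x \<bullet> y)\<^sup>2) \<and> integrable \<mu> (\<lambda>x. (x \<bullet> y) ^ 4) \<and>
    (LINT x|\<mu>. (x \<bullet> y) ^ 4) = 3 * (LINT x|\<mu>. (x \<bullet> y)\<^sup>2)\<^sup>2"
  proof (cases "distr \<mu> borel (\<lambda>x. x \<bullet> y) = return borel 0")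
    case True
    have "AE t in distr \<mu> borel (\<lambda>x. x \<bullet> y). t = 0"
      unfolding True by (simp add: AE_return)
    then have z: "AE x in \<mu>. x \<bullet> y = 0"
      by (subst (asm) AE_distr_iff) auto
    have "integrable \<mu> (\<lambda>x. (x \<bullet> y) ^ n) \<and> (LINT x|\<mu>. (x \<bullet> y) ^ n) = 0" if "n > 0" for n
    proof -
      have a: "AE x in \<mu>. (x \<bullet> y) ^ n = 0" using z by eventually_elim (use that in simp)
      show ?thesis
        using integrable_cong_AE[of "\<lambda>x. (x \<bullet> y) ^ n" \<mu> "\<lambda>_. 0"] a
          integral_cong_AE[of "\<lambda>x. (x \<bullet> y) ^ n" \<mu> "\<lambda>_. 0"] by simp
    qed
    from this[of 2] this[of 4] show ?thesis by simp
  next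
    case False
    then obtain \<sigma> where \<sigma>: "\<sigma> > 0" "distributed \<mu> lborel (\<lambda>x. x \<bullet> y) (normal_density 0 \<sigma>)"
      using assms unfolding centered_gaussian_measure_def by blast
    have m: "integrable \<mu> (\<lambda>x. (x \<bullet> y) ^ (2 * k))"
        "(LINT x|\<mu>. (x \<bullet> y) ^ (2 * k)) = fact (2 * k) / ((2 / \<sigma>\<^sup>2) ^ k * fact k)" for k
      using normal_moment_even[OF \<sigma>(1), of 0 k]
        distributed_integrable[OF \<sigma>(2), of "\<lambda>t. t ^ (2 * k)"]
        distributed_integral[OF \<sigma>(2), of "\<lambda>t. t ^ (2 * k)"]
      by (auto simp: has_bochner_integral_iff)
    show ?thesis
      using m[of 1] m[of 2] \<sigma>(1)
      by (simp add: fact_numeral power2_eq_square power4_eq_xxxx field_simps)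
  qed
  then show "integrable \<mu> (\<lambda>x. (x \<bullet> y)\<^sup>2)" "integrable \<mu> (\<lambda>x. (x \<bullet> y) ^ 4)"
    "(LINT x|\<mu>. (x \<bullet> y) ^ 4) = 3 * (LINT x|\<mu>. (x \<bullet> y)\<^sup>2)\<^sup>2" by auto
qed

lemma covariance_operator_positive:
  assumes "centered_gaussian_measure \<mu>" "nondegenerate_measure \<mu>" "covariance_operator \<mu> Q" "y \<noteq> 0"
  shows "Q y \<bullet> y > 0"
proof -
  have *: "Q y \<bullet> y = (LINT x|\<mu>. (x \<bullet> y)\<^sup>2)"
    using assms(3) by (simp add: covariance_operator_def power2_eq_square)
  have "Q y \<bullet> y \<noteq> 0"
  proof
    assume "Q y \<bullet> y = 0"
    then have "AE x in \<mu>. (x \<bullet> y)\<^sup>2 = 0"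
      using integral_nonneg_eq_0_iff_AE[OF centered_gaussian_moments(1)[OF assms(1), of y]] *
      by simp
    then show False using assms(2,4) unfolding nondegenerate_measure_def by auto
  qed
  moreover have "Q y \<bullet> y \<ge> 0" unfolding * by simp
  ultimately show ?thesis by simp
qed

lemma covariance_operator_inj:
  assumes "centered_gaussian_measure \<mu>" "nondegenerate_measure \<mu>" "covariance_operator \<mu> Q"
  shows "inj Q"
proof -
  have "linear Q"
    using assms(3) by (simp add: covariance_operator_def bounded_linear.linear)
  then show ?thesis
    using covariance_operator_positive[OF assms]
    by (metis inner_zero_left less_irrefl linear_injective_0)
qed

lemma bessel:
  fixes e :: "nat \<Rightarrow> 'b::real_inner"
  assumes "orthonormal_basis e"
  shows "(\<Sum>k<n. (x \<bullet> e k)\<^sup>2) \<le> (norm x)\<^sup>2"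
proof -
  let ?p = "\<Sum>k<n. (x \<bullet> e k) *\<^sub>R e k"
  have on: "e i \<bullet> e j = (if i = j then 1 else 0)" for i j
    using assms by (simp add: orthonormal_basis_def)
  have xp: "x \<bullet> ?p = (\<Sum>k<n. (x \<bullet> e k)\<^sup>2)"
    by (simp add: inner_sum_right power2_eq_square)
  have pp: "?p \<bullet> ?p = (\<Sum>k<n. (x \<bullet> e k)\<^sup>2)"
    by (simp add: inner_sum_right inner_sum_left on power2_eq_square if_distrib cong: if_cong)
  have "0 \<le> (x - ?p) \<bullet> (x - ?p)" by simp
  also have "\<dots> = x \<bullet> x - 2 * (x \<bullet> ?p) + ?p \<bullet> ?p"
    by (simp add: inner_diff_left inner_diff_right inner_commute)
  finally show ?thesis using xp pp by (simp add: power2_norm_eq_inner)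
qed

lemma covariance_operator_trace_class:
  assumes G: "centered_gaussian_measure \<mu>" and Q: "covariance_operator \<mu> Q"
    and e: "eigensystem Q lam e"
  shows "summable lam"
proof (rule ccontr)
  assume nsum: "\<not> summable lam"
  interpret prob_space \<mu> using G by (simp add: centered_gaussian_measure_def)
  have [measurable_cong]: "sets \<mu> = sets borel"
    using G by (simp add: centered_gaussian_measure_def)
  have pos: "lam k > 0" and onb: "orthonormal_basis e" for k
    using e by (auto simp: eigensystem_def)
  have on: "e i \<bullet> e j = (if i = j then 1 else 0)" for i j
    using onb by (simp add: orthonormal_basis_def)
  have var: "(LINT x|\<mu>. (x \<bullet> e k)\<^sup>2) = lam k" for k
  proof -
    have "Q (e k) \<bullet> e k = lam k" using e by (simp add: eigensystem_def on)
    then show ?thesis using Q by (simp add: covariance_operator_def power2_eq_square)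
  qed
  note mom = centered_gaussian_moments[OF G]
  define S where "S n x = (\<Sum>k<n. (x \<bullet> e k)\<^sup>2)" for n x
  define m where "m n = (\<Sum>k<n. lam k)" for n
  have S_meas [measurable]: "S n \<in> borel_measurable \<mu>" for n
    unfolding S_def[abs_def] by measurable
  have S1: "integrable \<mu> (S n)" "(LINT x|\<mu>. S n x) = m n" for n
    unfolding S_def[abs_def] m_def using mom(1) var by (auto simp: Bochner_Integration.integral_sum)
  have prodI: "integrable \<mu> (\<lambda>x. (x \<bullet> e j)\<^sup>2 * (x \<bullet> e k)\<^sup>2)"
    and prodB: "(LINT x|\<mu>. (x \<bullet> e j)\<^sup>2 * (x \<bullet> e k)\<^sup>2) \<le> 3 * lam j * lam k" for j k
  proof -
    let ?a = "\<lambda>x. (x \<bullet> e j) ^ 4" and ?b = "\<lambda>x. (x \<bullet> e k) ^ 4"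
    let ?f = "\<lambda>x. ((lam k / lam j) * ?a x + (lam j / lam k) * ?b x) / 2"
    have le: "(x \<bullet> e j)\<^sup>2 * (x \<bullet> e k)\<^sup>2 \<le> ?f x" for x
    proof -
      let ?p = "(x \<bullet> e j)\<^sup>2" and ?q = "(x \<bullet> e k)\<^sup>2"
      have "0 \<le> (lam k * ?p - lam j * ?q)\<^sup>2 / (2 * lam j * lam k)"
        using pos[of j] pos[of k] by simp
      also have "\<dots> = ((lam k / lam j) * ?p\<^sup>2 + (lam j / lam k) * ?q\<^sup>2) / 2 - ?p * ?q"
        using pos[of j] pos[of k] by (simp add: field_simps power2_eq_square)
      finally show ?thesis by simp
    qed
    have fI: "integrable \<mu> ?f" using mom(2) by simp
    show I: "integrable \<mu> (\<lambda>x. (x \<bullet> e j)\<^sup>2 * (x \<bullet> e k)\<^sup>2)"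
    proof (rule Bochner_Integration.integrable_bound[OF fI])
      show "AE x in \<mu>. norm ((x \<bullet> e j)\<^sup>2 * (x \<bullet> e k)\<^sup>2) \<le> norm (?f x)"
        using order_trans[OF le abs_ge_self]
        by (intro AE_I2) (simp only: real_norm_def abs_mult abs_power2)
    qed measurable
    have "(LINT x|\<mu>. (x \<bullet> e j)\<^sup>2 * (x \<bullet> e k)\<^sup>2) \<le> (LINT x|\<mu>. ?f x)"
      by (rule integral_mono[OF I fI le])
    also have "\<dots> = ((lam k / lam j) * (3 * (lam j)\<^sup>2) + (lam j / lam k) * (3 * (lam k)\<^sup>2)) / 2"
      using mom(2,3) var by simp
    also have "\<dots> = 3 * lam j * lam k"
      using pos[of j] pos[of k] by (simp add: field_simps power2_eq_square)
    finally show "(LINT x|\<mu>. (x \<bullet> e j)\<^sup>2 * (x \<bullet> e k)\<^sup>2) \<le> 3 * lam j * lam k" .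
  qed
  have S_sq: "(S n x)\<^sup>2 = (\<Sum>j<n. \<Sum>k<n. (x \<bullet> e j)\<^sup>2 * (x \<bullet> e k)\<^sup>2)" for n x
    by (simp add: S_def power2_eq_square sum_product)
  have S2: "integrable \<mu> (\<lambda>x. (S n x)\<^sup>2)" "(LINT x|\<mu>. (S n x)\<^sup>2) \<le> 3 * (m n)\<^sup>2" for n
  proof -
    show "integrable \<mu> (\<lambda>x. (S n x)\<^sup>2)" unfolding S_sq using prodI by simp
    have "(LINT x|\<mu>. (S n x)\<^sup>2) = (\<Sum>j<n. \<Sum>k<n. LINT x|\<mu>. (x \<bullet> e j)\<^sup>2 * (x \<bullet> e k)\<^sup>2)"
      unfolding S_sq using prodI by (simp add: Bochner_Integration.integral_sum)
    also have "\<dots> \<le> (\<Sum>j<n. \<Sum>k<n. 3 * lam j * lam k)" by (intro sum_mono prodB)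
    also have "\<dots> = 3 * (m n)\<^sup>2"
      unfolding m_def power2_eq_square sum_product
      by (simp only: sum_distrib_left mult.assoc)
    finally show "(LINT x|\<mu>. (S n x)\<^sup>2) \<le> 3 * (m n)\<^sup>2" .
  qed
  \<comment> \<open>a Paley--Zygmund estimate: the mass of \<open>{S n \<ge> m n / 2}\<close> is bounded below uniformly in \<open>n\<close>\<close>
  have PZ: "1/12 \<le> measure \<mu> {x \<in> space \<mu>. m n / 2 \<le> (norm x)\<^sup>2}" if mp: "m n > 0" for n
  proof -
    let ?E = "{x \<in> space \<mu>. m n / 2 \<le> (norm x)\<^sup>2}"
    have E [measurable]: "?E \<in> sets \<mu>" by measurable
    have "S n x \<le> m n / 2 + (3 * m n) * indicator ?E x + (S n x)\<^sup>2 / (12 * m n)"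
      if "x \<in> space \<mu>" for x
    proof (cases "x \<in> ?E")
      case True
      have "0 \<le> (S n x - 6 * m n)\<^sup>2 / (12 * m n)" using mp by simp
      also have "\<dots> = (S n x)\<^sup>2 / (12 * m n) - S n x + 3 * m n"
        using mp by (simp add: field_simps power2_eq_square)
      finally show ?thesis using True mp by simp
    next
      case False
      then have "S n x < m n / 2"
        using that bessel[OF onb, where x = x and n = n] by (auto simp: S_def)
      moreover have "0 \<le> (S n x)\<^sup>2 / (12 * m n)" using mp by simp
      ultimately show ?thesis using False by simp
    qed
    then have "(LINT x|\<mu>. S n x) \<le>
        (LINT x|\<mu>. m n / 2 + (3 * m n) * indicator ?E x + (S n x)\<^sup>2 / (12 * m n))"
      using S1 S2 E by (intro integral_mono) (auto simp: emeasure_eq_measure)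
    also have "\<dots> = m n / 2 + 3 * m n * measure \<mu> ?E + (LINT x|\<mu>. (S n x)\<^sup>2) / (12 * m n)"
      using S2 E by (simp add: emeasure_eq_measure prob_space)
    also have "\<dots> \<le> m n / 2 + 3 * m n * measure \<mu> ?E + 3 * (m n)\<^sup>2 / (12 * m n)"
      using S2(2)[of n] mp by (intro add_left_mono divide_right_mono) auto
    also have "\<dots> = m n * (3/4 + 3 * measure \<mu> ?E)"
      using mp by (simp add: field_simps power2_eq_square)
    finally have "m n * 1 \<le> m n * (3/4 + 3 * measure \<mu> ?E)" using S1(2)[of n] by simp
    then have "1 \<le> 3/4 + 3 * measure \<mu> ?E" using mp by (simp only: mult_le_cancel_left_pos)
    then show ?thesis by simp
  qed
  have lower: "1/12 \<le> measure \<mu> {x \<in> space \<mu>. real i \<le> (norm x)\<^sup>2}" for i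
  proof -
    have "\<exists>n. m n > 2 * real i"
    proof (rule ccontr)
      assume "\<nexists>n. m n > 2 * real i"
      then have "(\<Sum>k<n. lam k) \<le> 2 * real i" for n unfolding m_def by (simp add: not_less)
      then have "summable lam"
        using pos by (intro bounded_imp_summable[of lam "2 * real i"])
          (auto simp: less_imp_le lessThan_Suc_atMost[symmetric] simp del: sum.lessThan_Suc)
      with nsum show False ..
    qed
    then obtain n where n: "m n > 2 * real i" ..
    then have "1/12 \<le> measure \<mu> {x \<in> space \<mu>. m n / 2 \<le> (norm x)\<^sup>2}" by (intro PZ) linarith
    also have "\<dots> \<le> measure \<mu> {x \<in> space \<mu>. real i \<le> (norm x)\<^sup>2}"
      using n by (intro finite_measure_mono) auto
    finally show ?thesis .
  qed
  let ?F = "\<lambda>i. {x \<in> space \<mu>. real i \<le> (norm x)\<^sup>2}"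
  have "(\<lambda>i. measure \<mu> (?F i)) \<longlonglongrightarrow> measure \<mu> (\<Inter>i. ?F i)"
  proof (rule finite_Lim_measure_decseq)
    show "decseq ?F" by (auto simp: decseq_def intro: order_trans[rotated])
  qed auto
  moreover have "(\<Inter>i. ?F i) = {}"
    using reals_Archimedean2 by (auto simp: not_le set_eq_iff)
  ultimately have "(\<lambda>i. measure \<mu> (?F i)) \<longlonglongrightarrow> 0" by simp
  then have "1/12 \<le> (0::real)" using lower by (intro LIMSEQ_le_const) auto
  then show False by simp
qed

text \<open>The series defining \<open>\<Phi>\<close> converges, so its value is not an artefact of totality.\<close>

lemma \<Phi>_summable:
  assumes G: "centered_gaussian_measure \<mu>" "nondegenerate_measure \<mu>" "covariance_operator \<mu> Q"
    and e: "eigensystem Q lam e" and ran: "range A \<subseteq> range Q"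
  shows "summable (\<lambda>k. (A u \<bullet> e k)\<^sup>2 / (2 * lam k) - (A u \<bullet> e k) * (y \<bullet> e k) / lam k)"
proof -
  have onb: "orthonormal_basis e" and pos: "lam k > 0" and eig: "Q (e k) = lam k *\<^sub>R e k" for k
    using e by (auto simp: eigensystem_def)
  obtain w where w: "A u = Q w" using ran by blast
  have Au: "A u \<bullet> e k = lam k * (w \<bullet> e k)" for k
    unfolding w covariance_operator_self_adjoint[OF G(3)] eig by simp
  have sq: "summable (\<lambda>k. (x \<bullet> e k)\<^sup>2)" for x
    using bessel[OF onb, of x]
    by (intro bounded_imp_summable[of _ "(norm x)\<^sup>2"]) (auto simp: lessThan_Suc_atMost[symmetric]
      simp del: sum.lessThan_Suc)
  have prod: "summable (\<lambda>k. (a \<bullet> e k) * (b \<bullet> e k))" for a b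
  proof (rule summable_comparison_test'[of "\<lambda>k. (a \<bullet> e k)\<^sup>2 + (b \<bullet> e k)\<^sup>2" 0])
    show "summable (\<lambda>k. (a \<bullet> e k)\<^sup>2 + (b \<bullet> e k)\<^sup>2)" by (intro summable_add sq)
    show "norm ((a \<bullet> e k) * (b \<bullet> e k)) \<le> (a \<bullet> e k)\<^sup>2 + (b \<bullet> e k)\<^sup>2" for k
    proof -
      have "2 * \<bar>a \<bullet> e k\<bar> * \<bar>b \<bullet> e k\<bar> \<le> (a \<bullet> e k)\<^sup>2 + (b \<bullet> e k)\<^sup>2"
        using sum_squares_bound[of "\<bar>a \<bullet> e k\<bar>" "\<bar>b \<bullet> e k\<bar>"] by simp
      moreover have "0 \<le> \<bar>a \<bullet> e k\<bar> * \<bar>b \<bullet> e k\<bar>" by simp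
      ultimately show ?thesis unfolding real_norm_def abs_mult by linarith
    qed
  qed
  have "summable (\<lambda>k. (A u \<bullet> e k) * (w \<bullet> e k) / 2 - (w \<bullet> e k) * (y \<bullet> e k))"
    by (intro summable_diff summable_divide prod)
  moreover have "(A u \<bullet> e k) * (w \<bullet> e k) / 2 - (w \<bullet> e k) * (y \<bullet> e k) =
      (A u \<bullet> e k)\<^sup>2 / (2 * lam k) - (A u \<bullet> e k) * (y \<bullet> e k) / lam k" for k
    using pos[of k] by (simp add: Au field_simps power2_eq_square)
  ultimately show ?thesis by simp
qed

end

theory Submission
  imports Defs
begin

text \<open>
  Put \<open>w = Q\<^sup>-\<^sup>1 (A u)\<close>, a bounded linear function of \<open>u\<close>. Since \<open>(A u, e\<^sub>k) = \<lambda>\<^sub>k (w, e\<^sub>k)\<close>, Parseval's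
  identity sums the series to \<open>\<Phi>(u, y) = (Q w, w)/2 - (w, y)\<close>, a nonnegative bounded quadratic form
  plus a bounded linear functional. The first is Lipschitz on balls, and only the second contributes
  to the lower bound.
\<close>

text \<open>The partial sums \<open>P n\<close> reproduce each vector of the dense span from some
  index on, and the remainder maps \<open>z - P n z\<close> are contractions uniformly in
  \<open>n\<close>. Density carries convergence over to every \<open>x\<close>.\<close>

lemma orthonormal_basis_expansion:
  fixes e :: "nat \<Rightarrow> 'b::real_inner"
  assumes "orthonormal_basis e"
  shows "(\<lambda>k. (x \<bullet> e k) *\<^sub>R e k) sums x"
proof -
  define P where "P n z = (\<Sum>k<n. (z \<bullet> e k) *\<^sub>R e k)" for n z
  have on: "e i \<bullet> e j = (if i = j then 1 else 0)" for i j
    using assms by (simp add: orthonormal_basis_def)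
  have contr: "norm (z - P n z) \<le> norm z" for n z
  proof -
    have zp: "z \<bullet> P n z = (\<Sum>k<n. (z \<bullet> e k)\<^sup>2)"
      by (simp add: P_def inner_sum_right power2_eq_square)
    have pp: "P n z \<bullet> P n z = (\<Sum>k<n. (z \<bullet> e k)\<^sup>2)"
      by (simp add: P_def inner_sum_right inner_sum_left on power2_eq_square if_distrib cong: if_cong)
    \<comment> \<open>Pythagoras: \<open>P n z\<close> is the orthogonal projection onto the span of
      the first \<open>n\<close> basis vectors.\<close>
    have "(norm (z - P n z))\<^sup>2 = (norm z)\<^sup>2 - (\<Sum>k<n. (z \<bullet> e k)\<^sup>2)"
      using zp pp
      by (simp add: power2_norm_eq_inner inner_diff_left inner_diff_right inner_commute)
    also have "\<dots> \<le> (norm z)\<^sup>2" by (simp add: sum_nonneg)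
    finally show ?thesis by (rule power2_le_imp_le) simp
  qed
  have P_add: "P n (a + b) = P n a + P n b" for n a b
    by (simp add: P_def inner_add_left scaleR_add_left sum.distrib)
  have P_diff: "P n (a - b) = P n a - P n b" for n a b
    by (simp add: P_def inner_diff_left scaleR_diff_left sum_subtractf)
  have P_scale: "P n (c *\<^sub>R a) = c *\<^sub>R P n a" for n c a
    by (simp add: P_def scaleR_sum_right)
  have fix_span: "\<forall>\<^sub>F n in sequentially. P n s = s" if "s \<in> span (range e)" for s
    using that
  proof (induction rule: span_induct_alt)
    case base
    show ?case by (simp add: P_def)
  next
    case (step c b z)
    then obtain j where j: "b = e j" by blast
    \<comment> \<open>The sum runs over \<open>k < n\<close>, so \<open>e j\<close> is reproduced
      exactly when \<open>n > j\<close>.\<close>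
    have "\<forall>\<^sub>F n in sequentially. P n b = b"
      using eventually_gt_at_top[of j]
      by eventually_elim (simp add: P_def j on if_distrib[of "\<lambda>t. t *\<^sub>R _"] cong: if_cong)
    with step.IH show ?case
      by eventually_elim (simp add: P_add P_scale)
  qed
  have "(\<lambda>n. P n x) \<longlonglongrightarrow> x"
  proof (rule tendstoI)
    fix \<epsilon> :: real assume "\<epsilon> > 0"
    moreover have "x \<in> closure (span (range e))"
      using assms by (simp add: orthonormal_basis_def)
    ultimately obtain s where s: "s \<in> span (range e)" "dist s x < \<epsilon>"
      unfolding closure_approachable by blast
    from fix_span[OF s(1)] show "\<forall>\<^sub>F n in sequentially. dist (P n x) x < \<epsilon>"
    proof eventually_elim
      case (elim n)
      \<comment> \<open>Since \<open>P n s = s\<close>, the error at \<open>x\<close> equals the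
        error at \<open>x - s\<close>.\<close>
      have "dist (P n x) x = norm ((x - s) - P n (x - s))"
        using elim by (simp add: P_diff dist_norm norm_minus_commute)
      also have "\<dots> \<le> norm (x - s)" by (rule contr)
      also have "\<dots> < \<epsilon>" using s(2) by (simp add: dist_norm norm_minus_commute)
      finally show ?case .
    qed
  qed
  then show ?thesis by (simp add: sums_def P_def)
qed

lemma parseval_sums:
  fixes e :: "nat \<Rightarrow> 'b::real_inner"
  assumes "orthonormal_basis e"
  shows "(\<lambda>k. (x \<bullet> e k) * (y \<bullet> e k)) sums (x \<bullet> y)"
  using bounded_linear.sums[OF bounded_linear_inner_left orthonormal_basis_expansion[OF assms, of x], of y]
  by (simp add: inner_commute)

text \<open>One factor \<open>lam k\<close> from self-adjointness cancels the denominator, which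
  leaves products of coefficients for Parseval. Taking an arbitrary preimage \<open>w\<close> keeps
  \<open>inv Q\<close> out of the computation.\<close>

lemma \<Phi>_eq_quadratic_form:
  assumes Q: "covariance_operator \<mu> Q" and e: "eigensystem Q lam e" and w: "A u = Q w"
  shows "\<Phi> A lam e u y = (Q w \<bullet> w) / 2 - w \<bullet> y"
proof -
  have onb: "orthonormal_basis e" and pos: "lam k > 0" and eig: "Q (e k) = lam k *\<^sub>R e k" for k
    using e by (auto simp: eigensystem_def)
  have Au: "A u \<bullet> e k = lam k * (w \<bullet> e k)" for k
    unfolding w covariance_operator_self_adjoint[OF Q] eig by simp
  have "(\<lambda>k. (A u \<bullet> e k) * (w \<bullet> e k) / 2 - (w \<bullet> e k) * (y \<bullet> e k)) sums ((A u \<bullet> w) / 2 - w \<bullet> y)"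
    by (intro sums_diff sums_divide parseval_sums onb)
  moreover have "(A u \<bullet> e k) * (w \<bullet> e k) / 2 - (w \<bullet> e k) * (y \<bullet> e k) =
      (A u \<bullet> e k)\<^sup>2 / (2 * lam k) - (A u \<bullet> e k) * (y \<bullet> e k) / lam k" for k
    using pos[of k] by (simp add: Au field_simps power2_eq_square)
  ultimately show ?thesis by (simp add: \<Phi>_def sums_iff w)
qed

theorem corollary3p3:
  fixes \<mu> :: "'b::{real_inner, polish_space} measure"
    and Q :: "'b \<Rightarrow> 'b"
    and lam :: "nat \<Rightarrow> real"
    and e :: "nat \<Rightarrow> 'b"
    and A :: "'a::{real_inner, polish_space} \<Rightarrow> 'b"
  assumes "centered_gaussian_measure \<mu>" and "nondegenerate_measure \<mu>"
    and "covariance_operator \<mu> Q"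
    and "eigensystem Q lam e"
    and "linear A"
    and "range A \<subseteq> range Q"
    and "bounded_linear (\<lambda>u. inv Q (A u))"
  shows "\<forall>y.
    (\<forall>r>0. \<exists>L>0. \<forall>u\<^sub>1\<in>ball 0 r. \<forall>u\<^sub>2\<in>ball 0 r.
       \<bar>\<Phi> A lam e u\<^sub>1 y - \<Phi> A lam e u\<^sub>2 y\<bar> \<le> L * norm (u\<^sub>1 - u\<^sub>2)) \<and>
    (\<exists>L\<ge>0. \<forall>u. \<Phi> A lam e u y \<ge> \<Phi> A lam e 0 y - L * norm u)"
proof (intro allI conjI impI)
  define W where "W u = inv Q (A u)" for u
  have QW: "A u = Q (W u)" for u
    unfolding W_def using assms(6) by (simp add: f_inv_into_f range_subsetD)
  have \<Phi>_eq: "\<Phi> A lam e u y = (Q (W u) \<bullet> W u) / 2 - W u \<bullet> y" for u y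
    by (intro \<Phi>_eq_quadratic_form[OF assms(3,4)] QW)
  interpret Q: bounded_linear Q
    using assms(3) by (simp add: covariance_operator_def)
  interpret W: bounded_linear W
    using assms(7) by (simp add: W_def[abs_def])
  \<comment> \<open>Strictly positive bounds make the Lipschitz constant below positive even when
    \<open>y = 0\<close>.\<close>
  obtain K where K: "K > 0" "norm (Q x) \<le> norm x * K" for x
    using Q.pos_bounded by blast
  obtain B where B: "B > 0" "norm (W u) \<le> norm u * B" for u
    using W.pos_bounded by blast
  fix y
  {
    fix r :: real assume r: "r > 0"
    show "\<exists>L>0. \<forall>u\<^sub>1\<in>ball 0 r. \<forall>u\<^sub>2\<in>ball 0 r.
       \<bar>\<Phi> A lam e u\<^sub>1 y - \<Phi> A lam e u\<^sub>2 y\<bar> \<le> L * norm (u\<^sub>1 - u\<^sub>2)"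
    \<comment> \<open>In the variable \<open>w\<close> the gradient of the functional is
      \<open>Q w - y\<close>, of norm at most \<open>K * (B * r) + norm y\<close> when
      \<open>norm w \<le> B * r\<close>. The outer factor \<open>B\<close> is the Lipschitz constant
      of \<open>W\<close>.\<close>
    proof (intro exI[of _ "B * (K * (B * r) + norm y)"] conjI ballI)
      show "0 < B * (K * (B * r) + norm y)"
        using B(1) K(1) r by (intro mult_pos_pos add_pos_nonneg) auto
      fix u v :: 'a assume uv: "u \<in> ball 0 r" "v \<in> ball 0 r"
      \<comment> \<open>For a quadratic functional the increment is exactly the gradient at the
        midpoint \<open>m\<close> paired with \<open>d\<close>; the cross terms cancel because
        \<open>Q\<close> is self-adjoint.\<close>
      define d m where "d = W u - W v" and "m = (1/2) *\<^sub>R (W u + W v)"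
      have d: "norm d \<le> B * norm (u - v)"
        using B(2)[of "u - v"] by (simp add: d_def W.diff mult.commute)
      have Wr: "norm (W z) \<le> B * r" if "z \<in> ball 0 r" for z
        using order_trans[OF B(2)[of z], of "r * B"] that B(1) by (simp add: mult.commute)
      have m: "norm m \<le> B * r"
        using Wr[OF uv(1)] Wr[OF uv(2)] norm_triangle_ineq[of "W u" "W v"] by (simp add: m_def)
      have "\<Phi> A lam e u y - \<Phi> A lam e v y = d \<bullet> (Q m - y)"
        using covariance_operator_self_adjoint[OF assms(3), of "W u" "W v"]
        by (simp add: \<Phi>_eq d_def m_def Q.add Q.scaleR inner_diff_left inner_diff_right
          inner_add_right inner_commute field_simps)
      also have "\<bar>\<dots>\<bar> \<le> norm d * norm (Q m - y)" by (rule Cauchy_Schwarz_ineq2)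
      also have "\<dots> \<le> (B * norm (u - v)) * (K * (B * r) + norm y)"
      proof (rule mult_mono[OF d])
        have "norm (Q m) \<le> K * (B * r)"
          using order_trans[OF K(2) mult_right_mono[OF m, of K]] K(1) by (simp add: mult.commute)
        then show "norm (Q m - y) \<le> K * (B * r) + norm y"
          using norm_triangle_ineq4[of "Q m" y] by linarith
      qed (use B(1) in auto)
      finally show "\<bar>\<Phi> A lam e u y - \<Phi> A lam e v y\<bar> \<le> B * (K * (B * r) + norm y) * norm (u - v)"
        by (simp add: ac_simps)
    qed
  }
  show "\<exists>L\<ge>0. \<forall>u. \<Phi> A lam e u y \<ge> \<Phi> A lam e 0 y - L * norm u"
  \<comment> \<open>The witness bounds the linear functional \<open>W u \<bullet> y\<close>; the
    value at \<open>u = 0\<close> is 0.\<close>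
  proof (intro exI[of _ "B * norm y"] conjI allI)
    show "0 \<le> B * norm y" using B(1) by simp
    fix u
    \<comment> \<open>By the definition of the covariance this is the integral of a square.\<close>
    have "0 \<le> Q (W u) \<bullet> W u"
      using assms(3) by (simp add: covariance_operator_def)
    moreover have "W u \<bullet> y \<le> B * norm y * norm u"
      using norm_cauchy_schwarz[of "W u" y] mult_right_mono[OF B(2)[of u], of "norm y"]
      by (simp add: ac_simps)
    ultimately show "\<Phi> A lam e u y \<ge> \<Phi> A lam e 0 y - B * norm y * norm u"
      by (simp add: \<Phi>_eq W.zero Q.zero)
  qed
qed

end
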